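(* There exists a universal constant $c_1 \ge 1$ such that for all integers $m \ge 1$ and $n \ge 2$, every $m$-homogeneous polynomial $P : \mathbb{C}^n \to \mathbb{C}$, every $1$-unconditional norm $\|\cdot\|$ on $\mathbb{C}^n$ and every $1 \le k \le m$, $$\sup_{\substack{x^{(1)},\dots,x^{(m)} \in \mathbb{C}^n\\ \|x^{(j)}\| \le 1 \text{ for all } j}} \bigl| \mathcal{S}_{k-1} L_P\bigl(x^{(1)}, \dots, x^{(m)}\bigr) \bigr| \;\le\; (c_1 \log n)^{k} \cdot \sup_{\substack{x^{(1)},\dots,x^{(m)} \in \mathbb{C}^n\\ \|x^{(j)}\| \le 1 \text{ for all } j}} \bigl| \mathcal{S}_{k} L_P\bigl(x^{(1)}, \dots, x^{(m)}\bigr) \bigr| .$$ Moreover, for every $1 \le p < 2$ there is a constant $c_2 = c_2(p) \ge 1$, depending only on $p$, such that for all integers $m,n \ge 1$, every $m$-homogeneous polynomial $P : \mathbb{C}^n \to \mathbb{C}$ and every $1 \le k \le m$, $$\sup_{\substack{x^{(1)},\dots,x^{(m)} \in \mathbb{C}^n\\ \|x^{(j)}\|_p \le 1 \text{ for all } j}} \bigl| \mathcal{S}_{k-1} L_P\bigl(x^{(1)}, \dots, x^{(m)}\bigr) \bigr| \;\le\; c_2^{k} \cdot \sup_{\substack{x^{(1)},\dots,x^{(m)} \in \mathbb{C}^n\\ \|x^{(j)}\|_p \le 1 \text{ for all } j}} \bigl| \mathcal{S}_{k} L_P\bigl(x^{(1)}, \dots, x^{(m)}\bigr) \bigr| .$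$
   Context: Every $m$-homogeneous polynomial $P : \mathbb{C}^n \to \mathbb{C}$ has a unique representation $$P(x) = \sum_{1 \le j_1 \le \dots \le j_m \le n} c_{(j_1,\dots,j_m)}\, x_{j_1} \cdots x_{j_m}.$$ The (in general non-symmetric) $m$-linear form $L_P : (\mathbb{C}^n)^m \to \mathbb{C}$ associated to $P$ is $$L_P\bigl(x^{(1)}, \dots, x^{(m)}\bigr) := \sum_{1 \le j_1 \le \dots \le j_m \le n} c_{(j_1,\dots,j_m)}\, x^{(1)}_{j_1} \cdots x^{(m)}_{j_m}.$$ For $1 \le k \le m$ the partial symmetrization $\mathcal{S}_k L_P : (\mathbb{C}^n)^m \to \mathbb{C}$ is $$\mathcal{S}_k L_P\bigl(x^{(1)}, \dots, x^{(m)}\bigr) := \frac{1}{k!} \sum_{\sigma \in \Sigma_k} L_P\bigl(x^{(\sigma(1))}, \dots, x^{(\sigma(k))}, x^{(k+1)}, \dots, x^{(m)}\bigr),$$ where $\Sigma_k$ is the set of all permutations of $\{1,\dots,k\}$; and $\mathcal{S}_0 L_P := L_P$ (so $\mathcal{S}_0 L_P = \mathcal{S}_1 L_P = L_P$). A norm $\|\cdot\|$ on $\mathbb{C}^n$ is $1$-unconditional if for $x,y\in\mathbb{C}^n$, $|x_k| \le |y_k|$ for every $k$ implies $\|x\| \le \|y\|$. $\|\cdot\|_p$ denotes the $\ell_p$-norm on $\mathbb{C}^n$. *)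

theory Defs
  imports
    Complex_Main
    "HOL-Library.FuncSet"
    "HOL-Combinatorics.Permutations"
    "HOL-Computational_Algebra.Polynomial"
    "Jordan_Normal_Form.Matrix"
begin

text \<open>
  The constants in the theorem are uniform in the dimension, so \<open>\<complex>\<^sup>n\<close> is
  \<open>carrier_vec n :: complex vec set\<close>. Its coordinates are numbered \<open>0, \<dots>, n - 1\<close>; the \<open>m\<close> factors of
  a monomial and the \<open>m\<close> arguments of a multilinear form are numbered \<open>1, \<dots>, m\<close>.
\<close>

definition mono_indices :: "nat \<Rightarrow> nat \<Rightarrow> (nat \<Rightarrow> nat) set" where
  "mono_indices m n = {j \<in> {1..m} \<rightarrow>\<^sub>E {..<n}. mono_on {1..m} j}"

definition represents ::
  "nat \<Rightarrow> nat \<Rightarrow> ((nat \<Rightarrow> nat) \<Rightarrow> complex) \<Rightarrow> (complex vec \<Rightarrow> complex) \<Rightarrow> bool" where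
  "represents m n c P \<longleftrightarrow>
     (\<forall>x\<in>carrier_vec n. P x = (\<Sum>j\<in>mono_indices m n. c j * (\<Prod>i=1..m. x $ j i)))"

text \<open>Only the values of \<open>P\<close> on \<open>carrier_vec n\<close> matter.\<close>

definition homogeneous_polynomial :: "nat \<Rightarrow> nat \<Rightarrow> (complex vec \<Rightarrow> complex) \<Rightarrow> bool" where
  "homogeneous_polynomial m n P \<longleftrightarrow> (\<exists>c. represents m n c P)"

text \<open>
  Membership in \<open>extensional\<close> fixes the irrelevant values of \<open>c\<close> off the index set; the description
  is proper by \<open>ex1_coefficients\<close> below.
\<close>

definition coefficients ::
  "nat \<Rightarrow> nat \<Rightarrow> (complex vec \<Rightarrow> complex) \<Rightarrow> (nat \<Rightarrow> nat) \<Rightarrow> complex" where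
  "coefficients m n P = (THE c. c \<in> extensional (mono_indices m n) \<and> represents m n c P)"

definition assoc_form ::
  "nat \<Rightarrow> nat \<Rightarrow> (complex vec \<Rightarrow> complex) \<Rightarrow> (nat \<Rightarrow> complex vec) \<Rightarrow> complex" where
  "assoc_form m n P x =
     (\<Sum>j\<in>mono_indices m n. coefficients m n P j * (\<Prod>i=1..m. x i $ j i))"

text \<open>A permutation of \<open>{1..k}\<close> fixes every index above \<open>k\<close>.\<close>

definition partial_symmetrization ::
  "nat \<Rightarrow> ((nat \<Rightarrow> complex vec) \<Rightarrow> complex) \<Rightarrow> (nat \<Rightarrow> complex vec) \<Rightarrow> complex" where
  "partial_symmetrization k L x = (1 / fact k) * (\<Sum>\<sigma> | \<sigma> permutes {1..k}. L (\<lambda>i. x (\<sigma> i)))"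

lemma partial_symmetrization_0: "partial_symmetrization 0 L = L"
proof -
  have "{\<sigma>. \<sigma> permutes {1..0::nat}} = {id}" by (auto simp: fun_eq_iff)
  then show ?thesis by (simp add: partial_symmetrization_def fun_eq_iff)
qed

definition norm_on_Cn :: "nat \<Rightarrow> (complex vec \<Rightarrow> real) \<Rightarrow> bool" where
  "norm_on_Cn n N \<longleftrightarrow>
     (\<forall>x\<in>carrier_vec n. N x \<ge> 0 \<and> (N x = 0 \<longleftrightarrow> x = 0\<^sub>v n)) \<and>
     (\<forall>a. \<forall>x\<in>carrier_vec n. N (a \<cdot>\<^sub>v x) = cmod a * N x) \<and>
     (\<forall>x\<in>carrier_vec n. \<forall>y\<in>carrier_vec n. N (x + y) \<le> N x + N y)"

definition one_unconditional :: "nat \<Rightarrow> (complex vec \<Rightarrow> real) \<Rightarrow> bool" where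
  "one_unconditional n N \<longleftrightarrow>
     (\<forall>x\<in>carrier_vec n. \<forall>y\<in>carrier_vec n.
        (\<forall>i<n. cmod (x $ i) \<le> cmod (y $ i)) \<longrightarrow> N x \<le> N y)"

definition lp_norm :: "real \<Rightarrow> complex vec \<Rightarrow> real" where
  "lp_norm p x = (\<Sum>i<dim_vec x. cmod (x $ i) powr p) powr (1 / p)"

text \<open>
  For a multilinear form and a norm the range below is bounded, so the real-valued supremum is the
  genuine one.
\<close>

definition sup_on_balls ::
  "nat \<Rightarrow> nat \<Rightarrow> (complex vec \<Rightarrow> real) \<Rightarrow> ((nat \<Rightarrow> complex vec) \<Rightarrow> complex) \<Rightarrow> real" where
  "sup_on_balls m n N L =
     (SUP x \<in> {1..m} \<rightarrow>\<^sub>E {v \<in> carrier_vec n. N v \<le> 1}. cmod (L x))"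

lemma finite_mono_indices: "finite (mono_indices m n)"
  unfolding mono_indices_def by (rule finite_subset[of _ "{1..m} \<rightarrow>\<^sub>E {..<n}"]) (auto intro: finite_PiE)

text \<open>Kronecker substitution exponents separate the nondecreasing index tuples.\<close>

lemma kronecker_inj:
  fixes j j' :: "nat \<Rightarrow> nat"
  assumes "m < B" "mono_on {1..m} j" "mono_on {1..m} j'"
    and "(\<Sum>i=1..m. B ^ j i) = (\<Sum>i=1..m. B ^ j' i)"
  shows "\<forall>i\<in>{1..m}. j i = j' i"
  using assms
proof (induction m)
  case 0
  then show ?case by simp
next
  case (Suc m)
  have B: "B > 1" using Suc.prems(1) by simp
  have bounds: "B ^ f (Suc m) \<le> (\<Sum>i=1..Suc m. B ^ f i) \<and> (\<Sum>i=1..Suc m. B ^ f i) < B ^ Suc (f (Suc m))"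
    if "mono_on {1..Suc m} f" for f :: "nat \<Rightarrow> nat"
  proof
    show "B ^ f (Suc m) \<le> (\<Sum>i=1..Suc m. B ^ f i)" by simp
    have "(\<Sum>i=1..Suc m. B ^ f i) \<le> (\<Sum>i=1..Suc m. B ^ f (Suc m))"
      using that B by (intro sum_mono power_increasing) (auto simp: mono_on_def)
    also have "\<dots> = Suc m * B ^ f (Suc m)" by simp
    also have "\<dots> < B * B ^ f (Suc m)" using Suc.prems(1) B by (intro mult_strict_right_mono) auto
    finally show "(\<Sum>i=1..Suc m. B ^ f i) < B ^ Suc (f (Suc m))" by simp
  qed
  have "B ^ j (Suc m) < B ^ Suc (j' (Suc m))"
    using bounds[OF Suc.prems(2)] bounds[OF Suc.prems(3)] unfolding Suc.prems(4)
    by (blast intro: le_less_trans)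
  moreover have "B ^ j' (Suc m) < B ^ Suc (j (Suc m))"
    using bounds[OF Suc.prems(2)] bounds[OF Suc.prems(3)] unfolding Suc.prems(4)
    by (blast intro: le_less_trans)
  ultimately have top: "j (Suc m) = j' (Suc m)"
    using B by (metis power_strict_increasing_iff less_Suc_eq_le le_antisym)
  have "\<forall>i\<in>{1..m}. j i = j' i"
  proof (rule Suc.IH)
    show "mono_on {1..m} j" "mono_on {1..m} j'"
      using Suc.prems(2,3) by (auto simp: mono_on_def)
  qed (use Suc.prems(1,4) top in auto)
  with top show ?case by (auto simp: le_Suc_eq)
qed

lemma represents_unique:
  assumes c: "represents m n c P" and c': "represents m n c' P" and j0: "j0 \<in> mono_indices m n"
  shows "c j0 = c' j0"
proof -
  define J where "J = mono_indices m n"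
  define e :: "(nat \<Rightarrow> nat) \<Rightarrow> nat" where "e j = (\<Sum>i=1..m. Suc m ^ j i)" for j
  define p where "p = (\<Sum>j\<in>J. monom (c j - c' j) (e j))"
  have fin: "finite J" unfolding J_def by (rule finite_mono_indices)
  have "poly p t = 0" for t
  proof -
    define x where "x = vec n (\<lambda>i. t ^ (Suc m ^ i))"
    have x: "x \<in> carrier_vec n" by (simp add: x_def)
    have mon: "(\<Prod>i=1..m. x $ j i) = t ^ e j" if "j \<in> J" for j
    proof -
      have "j i < n" if "i \<in> {1..m}" for i
        using \<open>j \<in> J\<close> that by (auto simp: J_def mono_indices_def PiE_iff)
      then have "(\<Prod>i=1..m. x $ j i) = (\<Prod>i=1..m. t ^ (Suc m ^ j i))"
        by (intro prod.cong) (auto simp: x_def)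
      then show ?thesis by (simp add: e_def power_sum)
    qed
    have Px: "P x = (\<Sum>j\<in>J. d j * t ^ e j)" if "represents m n d P" for d
    proof -
      have "P x = (\<Sum>j\<in>J. d j * (\<Prod>i=1..m. x $ j i))"
        using that x by (simp add: represents_def J_def)
      also have "\<dots> = (\<Sum>j\<in>J. d j * t ^ e j)"
        using mon by (intro sum.cong) auto
      finally show ?thesis .
    qed
    have "(\<Sum>j\<in>J. c j * t ^ e j) = (\<Sum>j\<in>J. c' j * t ^ e j)"
      using Px[OF c] Px[OF c'] by simp
    then show ?thesis by (simp add: p_def poly_sum poly_monom algebra_simps sum_subtractf)
  qed
  then have p0: "p = 0" using poly_all_0_iff_0 by blast
  have inj: "e j = e j0 \<longleftrightarrow> j = j0" if "j \<in> J" for j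
  proof
    assume "e j = e j0"
    then have "\<forall>i\<in>{1..m}. j i = j0 i"
      using that j0 unfolding e_def J_def mono_indices_def
      by (intro kronecker_inj[of m "Suc m"]) auto
    then show "j = j0"
      using that j0 unfolding J_def mono_indices_def by (auto intro: PiE_ext)
  qed simp
  have "0 = coeff p (e j0)" using p0 by simp
  also have "\<dots> = (\<Sum>j\<in>J. if j = j0 then c j - c' j else 0)"
    unfolding p_def coeff_sum by (intro sum.cong) (auto simp: inj)
  also have "\<dots> = c j0 - c' j0" using fin j0 by (simp add: J_def)
  finally show ?thesis by simp
qed

lemma ex1_coefficients:
  assumes "homogeneous_polynomial m n P"
  shows "\<exists>!c. c \<in> extensional (mono_indices m n) \<and> represents m n c P"
proof -
  obtain c where c: "represents m n c P" using assms by (auto simp: homogeneous_polynomial_def)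
  then have "represents m n (restrict c (mono_indices m n)) P"
    by (simp add: represents_def cong: sum.cong)
  then have ex: "restrict c (mono_indices m n) \<in> extensional (mono_indices m n) \<and>
      represents m n (restrict c (mono_indices m n)) P" by simp
  show ?thesis
  proof (rule ex1I, rule ex)
    fix c' assume c': "c' \<in> extensional (mono_indices m n) \<and> represents m n c' P"
    show "c' = restrict c (mono_indices m n)"
    proof (rule extensionalityI[of _ "mono_indices m n"])
      fix j assume "j \<in> mono_indices m n"
      then show "c' j = restrict c (mono_indices m n) j"
        using represents_unique c' ex by blast
    qed (use c' in auto)
  qed
qed

end

theory Submission
  imports Defs "HOL-Analysis.Henstock_Kurzweil_Integration"
begin

hide_type (open) Finite_Cartesian_Product.vec
hide_const (open) Finite_Cartesian_Product.vec
unbundle no vec_syntax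

text \<open>
  Let \<open>a\<^bsub>k\<^esub> i\<close> be the coefficient of the \<open>k\<close>-th partial symmetrization at the index tuple \<open>i\<close>. Since the
  coefficients of the associated form live on nondecreasing tuples, \<open>a\<^bsub>k-1\<^esub> i\<close> vanishes unless
  \<open>i k\<close> is the largest of the first \<open>k\<close> entries, and in that case \<open>a\<^bsub>k-1\<^esub> i = (k / \<mu>) a\<^bsub>k\<^esub> i\<close>, where \<open>\<mu>\<close> is
  the number of the first \<open>k\<close> entries that equal \<open>i k\<close>. Hence one step of symmetrization is undone by a
  multiplier on the coefficients, and because \<open>1 / \<mu>\<close> is the integral of \<open>t ^ (\<mu> - 1)\<close> over \<open>[0, 1]\<close>,

    \<open>a\<^bsub>k-1\<^esub> i = k * integral {0..1} (\<lambda>t. (\<Prod>q<k. truncation t (i q) (i k)) * a\<^bsub>k\<^esub> i)\<close>.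

  For each \<open>t\<close> this is a product of \<open>k - 1\<close> multipliers, each of which sees two indices only
  (\<open>symm_coeff_integral\<close>). If \<open>truncation t\<close> enlarges the supremum of a bilinear form on
  the unit ball by a factor of at most \<open>C \<ge> 1\<close>, the step costs at most \<open>k C ^ (k - 1) \<le> (2 C) ^ k\<close>.

  So only the main triangle truncation of a bilinear form has to be bounded.

  \<^item> For an unconditional norm, arguments may be multiplied coordinatewise by numbers of modulus at
  most one. Averaging over signs shows that restricting a form to blocks on the diagonal costs
  nothing. The set \<open>u < v\<close> is the disjoint union, over the binary digits, of the sets on which \<open>u\<close> and
  \<open>v\<close> first differ at this digit, and each of these sets is cut out of diagonal blocks by a product of
  a condition on \<open>u\<close> and a condition on \<open>v\<close>. This gives a bound by the number of
  binary digits, which is of order \<open>log n\<close> (\<open>schur_bounded_truncation_solid\<close>).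

  \<^item> For \<open>\<ell>\<^sub>p\<close> with \<open>p < 2\<close> the splitting is adapted to the arguments \<open>x\<close> and \<open>y\<close> instead: cut the index set
  at a median of the mass \<open>\<bar>x\<^sub>u\<bar> powr p + \<bar>y\<^sub>u\<bar> powr p\<close>. A bilinear form restricted to indices of mass \<open>\<mu>\<close> is of
  size \<open>\<mu> powr (2 / p)\<close>, and because \<open>2 / p > 1\<close> the recursion over halves of equal mass is dominated by its
  first step, uniformly in \<open>n\<close> (\<open>truncated_sum_bound\<close>).
\<close>

section \<open>Schur multipliers of bilinear forms on a solid set\<close>

definition solid :: "nat \<Rightarrow> complex vec set \<Rightarrow> bool" where
  "solid n U \<longleftrightarrow> U \<subseteq> carrier_vec n \<and>
     (\<forall>x\<in>U. \<forall>y\<in>carrier_vec n. (\<forall>i<n. cmod (y $ i) \<le> cmod (x $ i)) \<longrightarrow> y \<in> U)"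

definition bform :: "nat \<Rightarrow> (nat \<Rightarrow> nat \<Rightarrow> complex) \<Rightarrow> complex vec \<Rightarrow> complex vec \<Rightarrow> complex" where
  "bform n b x y = (\<Sum>u<n. \<Sum>v<n. b u v * (x $ u * y $ v))"

definition schur_bounded ::
  "nat \<Rightarrow> complex vec set \<Rightarrow> (nat \<Rightarrow> nat \<Rightarrow> complex) \<Rightarrow> real \<Rightarrow> bool" where
  "schur_bounded n U M C \<longleftrightarrow>
     (\<forall>b K. (\<forall>x\<in>U. \<forall>y\<in>U. cmod (bform n b x y) \<le> K) \<longrightarrow>
            (\<forall>x\<in>U. \<forall>y\<in>U. cmod (bform n (\<lambda>u v. M u v * b u v) x y) \<le> C * K))"

lemma schur_boundedI:
  assumes "\<And>b K x y. (\<And>x y. x \<in> U \<Longrightarrow> y \<in> U \<Longrightarrow> cmod (bform n b x y) \<le> K) \<Longrightarrow> x \<in> U \<Longrightarrow> y \<in> U \<Longrightarrow>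
      cmod (bform n (\<lambda>u v. M u v * b u v) x y) \<le> C * K"
  shows "schur_bounded n U M C"
  using assms unfolding schur_bounded_def by blast

lemma schur_boundedD:
  assumes "schur_bounded n U M C" "\<And>x y. x \<in> U \<Longrightarrow> y \<in> U \<Longrightarrow> cmod (bform n b x y) \<le> K"
    "x \<in> U" "y \<in> U"
  shows "cmod (bform n (\<lambda>u v. M u v * b u v) x y) \<le> C * K"
  using assms unfolding schur_bounded_def by blast

lemma bform_cong:
  assumes "\<And>u v. u < n \<Longrightarrow> v < n \<Longrightarrow> b u v = b' u v"
  shows "bform n b x y = bform n b' x y"
  using assms unfolding bform_def by (intro sum.cong) auto

lemma schur_bounded_cong:
  assumes "schur_bounded n U M' C" "\<And>u v. u < n \<Longrightarrow> v < n \<Longrightarrow> M u v = M' u v"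
  shows "schur_bounded n U M C"
proof (rule schur_boundedI)
  fix b K x y
  assume "\<And>x y. x \<in> U \<Longrightarrow> y \<in> U \<Longrightarrow> cmod (bform n b x y) \<le> K" "x \<in> U" "y \<in> U"
  from schur_boundedD[OF assms(1) this]
  show "cmod (bform n (\<lambda>u v. M u v * b u v) x y) \<le> C * K"
    using assms(2) bform_cong[of n "\<lambda>u v. M u v * b u v" "\<lambda>u v. M' u v * b u v"] by simp
qed

lemma schur_bounded_one: "schur_bounded n U (\<lambda>_ _. 1) 1"
  by (rule schur_boundedI) simp

lemma schur_bounded_zero: "schur_bounded n U (\<lambda>_ _. 0) 0"
  by (rule schur_boundedI) (simp add: bform_def)

lemma schur_bounded_add:
  assumes "schur_bounded n U M C" "schur_bounded n U M' C'"
  shows "schur_bounded n U (\<lambda>u v. M u v + M' u v) (C + C')"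
proof (rule schur_boundedI)
  fix b K x y
  assume *: "\<And>x y. x \<in> U \<Longrightarrow> y \<in> U \<Longrightarrow> cmod (bform n b x y) \<le> K" "x \<in> U" "y \<in> U"
  have "bform n (\<lambda>u v. (M u v + M' u v) * b u v) x y =
      bform n (\<lambda>u v. M u v * b u v) x y + bform n (\<lambda>u v. M' u v * b u v) x y"
    by (simp add: bform_def algebra_simps sum.distrib)
  moreover note schur_boundedD[OF assms(1) *] schur_boundedD[OF assms(2) *]
  ultimately show "cmod (bform n (\<lambda>u v. (M u v + M' u v) * b u v) x y) \<le> (C + C') * K"
    by (simp add: distrib_right) (meson add_mono norm_triangle_ineq order_trans)
qed

lemma schur_bounded_scale:
  assumes "schur_bounded n U M C"
  shows "schur_bounded n U (\<lambda>u v. c * M u v) (cmod c * C)"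
proof (rule schur_boundedI)
  fix b K x y
  assume *: "\<And>x y. x \<in> U \<Longrightarrow> y \<in> U \<Longrightarrow> cmod (bform n b x y) \<le> K" "x \<in> U" "y \<in> U"
  have "bform n (\<lambda>u v. c * M u v * b u v) x y = c * bform n (\<lambda>u v. M u v * b u v) x y"
    by (simp add: bform_def sum_distrib_left mult.assoc)
  then show "cmod (bform n (\<lambda>u v. c * M u v * b u v) x y) \<le> cmod c * C * K"
    using schur_boundedD[OF assms *] by (simp add: norm_mult mult.assoc mult_left_mono)
qed

lemma schur_bounded_mono:
  assumes "schur_bounded n U M C" "C \<le> C'"
  shows "schur_bounded n U M C'"
proof (rule schur_boundedI)
  fix b K x y
  assume *: "\<And>x y. x \<in> U \<Longrightarrow> y \<in> U \<Longrightarrow> cmod (bform n b x y) \<le> K" "x \<in> U" "y \<in> U"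
  have "0 \<le> K" using *(1)[OF *(2,3)] norm_ge_zero order_trans by blast
  then show "cmod (bform n (\<lambda>u v. M u v * b u v) x y) \<le> C' * K"
    using schur_boundedD[OF assms(1) *] assms(2) by (meson mult_right_mono order_trans)
qed

text \<open>
  A factor that depends on one index alone can be moved into the corresponding argument, and a
  solid set contains the new argument.
\<close>

lemma schur_bounded_diag:
  assumes "solid n U" "schur_bounded n U M C"
    and \<alpha>: "\<And>u. cmod (\<alpha> u) \<le> 1" and \<beta>: "\<And>v. cmod (\<beta> v) \<le> 1"
  shows "schur_bounded n U (\<lambda>u v. M u v * (\<alpha> u * \<beta> v)) C"
proof (rule schur_boundedI)
  fix b K x y
  assume *: "\<And>x y. x \<in> U \<Longrightarrow> y \<in> U \<Longrightarrow> cmod (bform n b x y) \<le> K" "x \<in> U" "y \<in> U"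
  define x' where "x' = vec n (\<lambda>u. \<alpha> u * x $ u)"
  define y' where "y' = vec n (\<lambda>v. \<beta> v * y $ v)"
  have "x' \<in> U" "y' \<in> U"
    using assms(1) *(2,3) \<alpha> \<beta> unfolding solid_def x'_def y'_def
    by (auto simp: norm_mult mult_left_le_one_le)
  from schur_boundedD[OF assms(2) *(1) this]
  have "cmod (bform n (\<lambda>u v. M u v * b u v) x' y') \<le> C * K" by simp
  moreover have "bform n (\<lambda>u v. M u v * (\<alpha> u * \<beta> v) * b u v) x y = bform n (\<lambda>u v. M u v * b u v) x' y'"
    unfolding bform_def x'_def y'_def by (intro sum.cong) (auto simp: algebra_simps)
  ultimately show "cmod (bform n (\<lambda>u v. M u v * (\<alpha> u * \<beta> v) * b u v) x y) \<le> C * K" by simp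
qed

section \<open>Truncation on a solid set by binary digits\<close>

text \<open>
  Equality of two numbers \<open>r\<close> and \<open>s\<close> is equality of their halves together with equality of their parities,
  and the latter is \<open>(1 + (-1)\<^sup>r (-1)\<^sup>s) / 2\<close>, an average of diagonal multipliers. So no digit costs
  anything.
\<close>

lemma schur_bounded_eq:
  fixes f :: "nat \<Rightarrow> nat"
  assumes "solid n U" "\<And>u. u < n \<Longrightarrow> f u < 2 ^ d"
  shows "schur_bounded n U (\<lambda>u v. if f u = f v then 1 else 0) 1"
  using assms(2)
proof (induction d arbitrary: f)
  case 0
  show ?case using 0 by (intro schur_bounded_cong[OF schur_bounded_one]) force
next
  case (Suc d)
  define E :: "nat \<Rightarrow> nat \<Rightarrow> complex" where "E u v = (if f u div 2 = f v div 2 then 1 else 0)" for u v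
  define s :: "nat \<Rightarrow> complex" where "s u = (-1) ^ f u" for u
  have E: "schur_bounded n U E 1"
    unfolding E_def using Suc.prems by (intro Suc.IH) force
  have "schur_bounded n U (\<lambda>u v. E u v * (s u * s v)) 1"
    using assms(1) E by (intro schur_bounded_diag) (auto simp: s_def norm_power)
  from schur_bounded_scale[OF schur_bounded_add[OF E this], of "1/2"]
  have "schur_bounded n U (\<lambda>u v. 1/2 * (E u v + E u v * (s u * s v))) 1" by simp
  then show ?case
  proof (rule schur_bounded_cong)
    fix u v
    have "f u = f v \<longleftrightarrow> f u div 2 = f v div 2 \<and> (even (f u) \<longleftrightarrow> even (f v))" by presburger
    then show "(if f u = f v then 1 else 0) = 1/2 * (E u v + E u v * (s u * s v))"
      by (auto simp: E_def s_def)
  qed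
qed

text \<open>
  Either the comparison is decided by the halves, or the halves agree and the last digits are
  \<open>0\<close> and \<open>1\<close>. The second alternative is a diagonal modification of an equality multiplier, so
  each binary digit adds one to the bound.
\<close>

lemma schur_bounded_less:
  fixes f :: "nat \<Rightarrow> nat"
  assumes "solid n U" "\<And>u. u < n \<Longrightarrow> f u < 2 ^ d"
  shows "schur_bounded n U (\<lambda>u v. if f u < f v then 1 else 0) (real d)"
  using assms(2)
proof (induction d arbitrary: f)
  case 0
  show ?case using 0 by (simp, intro schur_bounded_cong[OF schur_bounded_zero]) force
next
  case (Suc d)
  define g where "g u = f u div 2" for u
  define M :: "nat \<Rightarrow> nat \<Rightarrow> complex" where "M u v = (if g u < g v then 1 else 0)" for u v
  define E :: "nat \<Rightarrow> nat \<Rightarrow> complex" where "E u v = (if g u = g v then 1 else 0)" for u v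
  define \<alpha> :: "nat \<Rightarrow> complex" where "\<alpha> u = of_bool (even (f u))" for u
  define \<beta> :: "nat \<Rightarrow> complex" where "\<beta> v = of_bool (odd (f v))" for v
  have g: "g u < 2 ^ d" if "u < n" for u using Suc.prems[OF that] unfolding g_def by force
  have "schur_bounded n U E 1" unfolding E_def using assms(1) g by (rule schur_bounded_eq)
  with assms(1) have "schur_bounded n U (\<lambda>u v. E u v * (\<alpha> u * \<beta> v)) 1"
    by (rule schur_bounded_diag) (auto simp: \<alpha>_def \<beta>_def)
  moreover have "schur_bounded n U M (real d)" unfolding M_def using g by (rule Suc.IH)
  ultimately have "schur_bounded n U (\<lambda>u v. M u v + E u v * (\<alpha> u * \<beta> v)) (real d + 1)"
    by (intro schur_bounded_add)
  then have "schur_bounded n U (\<lambda>u v. M u v + E u v * (\<alpha> u * \<beta> v)) (real (Suc d))"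
    by (simp add: add.commute)
  then show ?case
  proof (rule schur_bounded_cong)
    fix u v
    have "f u < f v \<longleftrightarrow> g u < g v \<or> g u = g v \<and> even (f u) \<and> odd (f v)"
      unfolding g_def by presburger
    then show "(if f u < f v then 1 else 0) = M u v + E u v * (\<alpha> u * \<beta> v)"
      by (auto simp: M_def E_def \<alpha>_def \<beta>_def)
  qed
qed

text \<open>
  The main triangle truncation. The parameter on the diagonal records ties: a product of truncations
  with a common second index that is maximal is \<open>t\<close> to the power of the number of ties.
\<close>

definition truncation :: "real \<Rightarrow> nat \<Rightarrow> nat \<Rightarrow> complex" where
  "truncation t u v = (if u < v then 1 else if u = v then of_real t else 0)"

lemma schur_bounded_truncation_solid:
  assumes "solid n U" "n \<le> 2 ^ d" "0 \<le> t" "t \<le> 1"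
  shows "schur_bounded n U (truncation t) (real d + 1)"
proof -
  have "u < n \<Longrightarrow> u < 2 ^ d" for u using assms(2) by simp
  note bound = schur_bounded_less[of n U "\<lambda>u. u" d, OF assms(1) this]
    schur_bounded_scale[OF schur_bounded_eq[of n U "\<lambda>u. u" d, OF assms(1) this], of "of_real t"]
  have "schur_bounded n U (truncation t) (real d + cmod (of_real t) * 1)"
    using schur_bounded_add[OF bound] by (rule schur_bounded_cong) (auto simp: truncation_def)
  then show ?thesis by (rule schur_bounded_mono) (use assms(3,4) in simp)
qed

section \<open>Truncation on the unit ball of \<open>\<ell>\<^sub>p\<close> for \<open>p < 2\<close>\<close>

definition lp_mass :: "real \<Rightarrow> complex vec \<Rightarrow> nat set \<Rightarrow> real" where
  "lp_mass p x A = (\<Sum>u\<in>A. cmod (x $ u) powr p)"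

lemma two_powr_less_one:
  fixes p :: real
  assumes "0 < p" "p < 2"
  shows "2 powr (1 - 2 / p) < (1::real)"
  using powr_less_mono[of "1 - 2 / p" 0 2] assms by (simp add: field_simps)

lemma lp_mass_nonneg: "0 \<le> lp_mass p x A"
  by (simp add: lp_mass_def sum_nonneg)

lemma lp_norm_conv_mass:
  assumes "x \<in> carrier_vec n"
  shows "lp_norm p x = lp_mass p x {..<n} powr (1 / p)"
  using assms by (simp add: lp_norm_def lp_mass_def)

lemma lp_norm_le_1_iff:
  assumes "x \<in> carrier_vec n" "p > 0"
  shows "lp_norm p x \<le> 1 \<longleftrightarrow> lp_mass p x {..<n} \<le> 1"
  using assms(2) lp_mass_nonneg[of p x "{..<n}"] unfolding lp_norm_conv_mass[OF assms(1)]
  by (metis divide_pos_pos less_numeral_extra(1) powr_less_mono2 powr_mono2 powr_one_eq_one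
      linorder_not_le order_less_imp_le zero_le_one)

lemma lp_mass_mono:
  assumes "finite B" "A \<subseteq> B"
  shows "lp_mass p x A \<le> lp_mass p x B"
  unfolding lp_mass_def using assms by (intro sum_mono2) auto

text \<open>Homogeneity turns the bound on the unit ball into a bound for arbitrary restrictions of vectors.\<close>

lemma bilinear_bound_lp_mass:
  assumes p: "p > 0"
    and bd: "\<And>x y. x \<in> {v \<in> carrier_vec n. lp_norm p v \<le> 1} \<Longrightarrow>
      y \<in> {v \<in> carrier_vec n. lp_norm p v \<le> 1} \<Longrightarrow> cmod (bform n b x y) \<le> K"
    and A: "A \<subseteq> {..<n}" and B: "B \<subseteq> {..<n}"
  shows "cmod (\<Sum>u\<in>A. \<Sum>v\<in>B. b u v * (x $ u * y $ v))
      \<le> K * lp_mass p x A powr (1 / p) * lp_mass p y B powr (1 / p)"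
proof -
  define X where "X = lp_mass p x A powr (1 / p)"
  define Y where "Y = lp_mass p y B powr (1 / p)"
  have fin: "finite A" "finite B" using A B finite_subset by blast+
  have zero: "z $ u = 0" if "lp_mass p z D = 0" "finite D" "u \<in> D" for z D u
    using that p by (auto simp: lp_mass_def sum_nonneg_eq_0_iff)
  show ?thesis
  proof (cases "X = 0 \<or> Y = 0")
    case True
    then have "(\<Sum>u\<in>A. \<Sum>v\<in>B. b u v * (x $ u * y $ v)) = 0"
      using zero fin unfolding X_def Y_def by (auto intro!: sum.neutral)
    then show ?thesis using True by (auto simp: X_def Y_def)
  next
    case False
    then have pos: "X > 0" "Y > 0" by (auto simp: X_def Y_def)
    define r where "r z D Z = vec n (\<lambda>u. if u \<in> D then z $ u / complex_of_real Z else 0)"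
      for z :: "complex vec" and D Z
    have r: "r z D Z \<in> {v \<in> carrier_vec n. lp_norm p v \<le> 1}"
      if "Z = lp_mass p z D powr (1 / p)" "Z > 0" "D \<subseteq> {..<n}" for z D Z
    proof -
      have Zp: "Z powr p = lp_mass p z D"
        using that p lp_mass_nonneg[of p z D] by (auto simp: powr_powr)
      have "lp_mass p (r z D Z) {..<n} = (\<Sum>u\<in>D. cmod (z $ u / complex_of_real Z) powr p)"
        unfolding lp_mass_def using that(3)
        by (intro sum.mono_neutral_cong_right) (auto simp: r_def)
      also have "\<dots> = (\<Sum>u\<in>D. cmod (z $ u) powr p / Z powr p)"
        using that(2) by (intro sum.cong) (auto simp: norm_divide powr_divide)
      also have "\<dots> = lp_mass p z D / Z powr p"
        by (simp add: lp_mass_def sum_divide_distrib)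
      also have "\<dots> = 1" using Zp that(2) by (metis divide_self powr_eq_0_iff less_irrefl)
      finally show ?thesis using lp_norm_le_1_iff[of "r z D Z" n p] p by (simp add: r_def)
    qed
    have "bform n b (r x A X) (r y B Y) = (\<Sum>u\<in>A. \<Sum>v<n. b u v * (r x A X $ u * r y B Y $ v))"
      unfolding bform_def using A by (intro sum.mono_neutral_right) (auto simp: r_def)
    also have "\<dots> = (\<Sum>u\<in>A. \<Sum>v\<in>B. b u v * (r x A X $ u * r y B Y $ v))"
      using B by (intro sum.cong[OF refl] sum.mono_neutral_right) (auto simp: r_def)
    also have "\<dots> = (\<Sum>u\<in>A. \<Sum>v\<in>B. b u v * (x $ u * y $ v)) / (X * Y)"
      using A B unfolding sum_divide_distrib by (intro sum.cong) (auto simp: r_def subset_iff)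
    finally have "cmod ((\<Sum>u\<in>A. \<Sum>v\<in>B. b u v * (x $ u * y $ v)) / (X * Y)) \<le> K"
      using bd[OF r r, of X x A Y y B] pos A B by (simp add: X_def Y_def)
    then show ?thesis using pos
      by (simp add: norm_divide norm_mult divide_le_eq mult.assoc flip: X_def Y_def)
  qed
qed

text \<open>
  The median is the first element at which the accumulated weight reaches one half; it belongs to
  neither side, so a single heavy element does no harm.
\<close>

lemma median_exists:
  fixes w :: "nat \<Rightarrow> real"
  assumes "finite A" "A \<noteq> {}" "\<And>u. 0 \<le> w u"
  obtains a where "a \<in> A" "2 * sum w {u \<in> A. u < a} \<le> sum w A" "2 * sum w {u \<in> A. a < u} \<le> sum w A"
proof -
  define G where "G = {a \<in> A. sum w A \<le> 2 * sum w {u \<in> A. u \<le> a}}"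
  have "{u \<in> A. u \<le> Max A} = A" using assms by auto
  then have "Max A \<in> G" using assms by (simp add: G_def sum_nonneg)
  then have G: "finite G" "G \<noteq> {}" using assms(1) unfolding G_def by auto
  define a where "a = Min G"
  have a: "a \<in> A" "sum w A \<le> 2 * sum w {u \<in> A. u \<le> a}"
    using Min_in[OF G] by (auto simp: a_def G_def)
  have "sum w A = sum w ({u \<in> A. u \<le> a} \<union> {u \<in> A. a < u})" by (intro arg_cong2[of _ _ _ _ sum]) auto
  also have "\<dots> = sum w {u \<in> A. u \<le> a} + sum w {u \<in> A. a < u}"
    using assms(1) by (intro sum.union_disjoint) auto
  finally have R: "2 * sum w {u \<in> A. a < u} \<le> sum w A" using a by simp
  have "2 * sum w {u \<in> A. u < a} \<le> sum w A"
  proof (cases "{u \<in> A. u < a} = {}")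
    case True
    then show ?thesis using assms by (simp only: True) (simp add: sum_nonneg)
  next
    case False
    define c where "c = Max {u \<in> A. u < a}"
    have c: "c \<in> A" "c < a" using Max_in[OF _ False] assms(1) by (auto simp: c_def)
    have eq: "{u \<in> A. u \<le> c} = {u \<in> A. u < a}" using assms(1) c by (auto simp: c_def)
    have "c \<notin> G" using c G Min_le[of G c] by (auto simp: a_def)
    then show ?thesis using c eq by (auto simp: G_def)
  qed
  with a R show ?thesis using that by blast
qed

text \<open>
  Splitting at an index \<open>a\<close> leaves two truncated sums over smaller sets and three sums in which the
  truncation is constant.
\<close>

lemma truncated_sum_split:
  fixes c :: "nat \<Rightarrow> nat \<Rightarrow> complex" and t :: real
  assumes "finite A" "a \<in> A" and L: "L = {u \<in> A. u < a}" and R: "R = {u \<in> A. a < u}"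
  defines "T \<equiv> \<lambda>D. \<Sum>u\<in>D. \<Sum>v\<in>D. truncation t u v * c u v"
  shows "T A = T L + T R + (\<Sum>u\<in>L. c u a) + of_real t * c a a + (\<Sum>u\<in>insert a L. \<Sum>v\<in>R. c u v)"
proof -
  have fin: "finite L" "finite R" "a \<notin> L" "a \<notin> R" "L \<inter> R = {}" using assms by auto
  have A: "A = insert a (L \<union> R)" using assms by auto
  have sumA: "sum f A = sum f L + f a + sum f R" for f :: "nat \<Rightarrow> complex"
    unfolding A using fin by (simp add: sum.union_disjoint add_ac)
  have 1: "(\<Sum>v\<in>A. truncation t u v * c u v) =
      (\<Sum>v\<in>L. truncation t u v * c u v) + c u a + (\<Sum>v\<in>R. c u v)" if "u \<in> L" for u
  proof -
    have "(\<Sum>v\<in>R. truncation t u v * c u v) = (\<Sum>v\<in>R. c u v)"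
      using that by (intro sum.cong) (auto simp: L R truncation_def)
    then show ?thesis using that by (simp add: sumA) (simp add: L truncation_def)
  qed
  have 2: "(\<Sum>v\<in>A. truncation t a v * c a v) = of_real t * c a a + (\<Sum>v\<in>R. c a v)"
  proof -
    have "(\<Sum>v\<in>R. truncation t a v * c a v) = (\<Sum>v\<in>R. c a v)"
      by (intro sum.cong) (auto simp: R truncation_def)
    moreover have "(\<Sum>v\<in>L. truncation t a v * c a v) = 0"
      by (intro sum.neutral) (auto simp: L truncation_def)
    ultimately show ?thesis by (simp add: sumA) (simp add: truncation_def)
  qed
  have 3: "(\<Sum>v\<in>A. truncation t u v * c u v) = (\<Sum>v\<in>R. truncation t u v * c u v)" if "u \<in> R" for u
  proof -
    have "(\<Sum>v\<in>L. truncation t u v * c u v) = 0"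
      using that by (intro sum.neutral) (auto simp: L R truncation_def)
    then show ?thesis using that by (simp add: sumA) (simp add: R truncation_def)
  qed
  have "T A = (\<Sum>u\<in>L. \<Sum>v\<in>A. truncation t u v * c u v) + (\<Sum>v\<in>A. truncation t a v * c a v)
      + (\<Sum>u\<in>R. \<Sum>v\<in>A. truncation t u v * c u v)"
    unfolding T_def by (rule sumA)
  also have "(\<Sum>u\<in>L. \<Sum>v\<in>A. truncation t u v * c u v) = T L + (\<Sum>u\<in>L. c u a) + (\<Sum>u\<in>L. \<Sum>v\<in>R. c u v)"
    unfolding T_def sum.distrib[symmetric] by (intro sum.cong refl 1)
  also have "(\<Sum>u\<in>R. \<Sum>v\<in>A. truncation t u v * c u v) = T R"
    unfolding T_def by (intro sum.cong refl 3)
  also note 2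
  also have "T L + (\<Sum>u\<in>L. c u a) + (\<Sum>u\<in>L. \<Sum>v\<in>R. c u v) + (of_real t * c a a + (\<Sum>v\<in>R. c a v)) + T R
      = T L + T R + (\<Sum>u\<in>L. c u a) + of_real t * c a a + (\<Sum>u\<in>insert a L. \<Sum>v\<in>R. c u v)"
    using fin by (simp add: algebra_simps)
  finally show ?thesis .
qed

text \<open>
  The divide-and-conquer estimate. Splitting at a median of the mass halves it, and \<open>2 / p > 1\<close> makes
  the two halves together contribute only the proportion \<open>2 powr (1 - 2 / p) < 1\<close> of the claimed
  bound; the three remaining rectangles are paid for by what is left.
\<close>

lemma truncated_sum_bound:
  fixes b :: "nat \<Rightarrow> nat \<Rightarrow> complex"
  assumes p: "0 < p" "p < 2" and t: "0 \<le> t" "t \<le> 1"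
    and bd: "\<And>x y. x \<in> {v \<in> carrier_vec n. lp_norm p v \<le> 1} \<Longrightarrow>
      y \<in> {v \<in> carrier_vec n. lp_norm p v \<le> 1} \<Longrightarrow> cmod (bform n b x y) \<le> K"
    and "0 \<le> K" "A \<subseteq> {..<n}"
  shows "cmod (\<Sum>u\<in>A. \<Sum>v\<in>A. truncation t u v * (b u v * (x $ u * y $ v)))
      \<le> 3 / (1 - 2 powr (1 - 2 / p)) * K * (lp_mass p x A + lp_mass p y A) powr (2 / p)"
proof -
  define \<rho> where "\<rho> = 2 powr (1 - 2 / p)"
  have "\<rho> < 1" unfolding \<rho>_def using p by (rule two_powr_less_one)
  define C where "C = 3 / (1 - \<rho>)"
  have C: "C > 0" "C * \<rho> + 3 = C" using \<open>\<rho> < 1\<close> by (auto simp: C_def field_simps)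
  define \<mu> where "\<mu> D = lp_mass p x D + lp_mass p y D" for D
  define c where "c u v = b u v * (x $ u * y $ v)" for u v
  define T where "T D = (\<Sum>u\<in>D. \<Sum>v\<in>D. truncation t u v * c u v)" for D
  have \<mu>0: "0 \<le> \<mu> D" for D by (simp add: \<mu>_def lp_mass_nonneg)
  have "finite A" using \<open>A \<subseteq> _\<close> finite_subset by blast
  then have "cmod (T A) \<le> C * K * \<mu> A powr (2 / p)" using \<open>A \<subseteq> _\<close>
  proof (induction A rule: finite_psubset_induct)
    case (psubset A)
    show ?case
    proof (cases "A = {}")
      case True
      then show ?thesis using C \<open>0 \<le> K\<close> by (simp add: T_def)
    next
      case False
      have \<mu>_sum: "\<mu> D = (\<Sum>u\<in>D. cmod (x $ u) powr p + cmod (y $ u) powr p)" for D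
        by (simp add: \<mu>_def lp_mass_def sum.distrib)
      obtain a where a: "a \<in> A" "2 * \<mu> {u \<in> A. u < a} \<le> \<mu> A" "2 * \<mu> {u \<in> A. a < u} \<le> \<mu> A"
        unfolding \<mu>_sum
        using median_exists[of A "\<lambda>u. cmod (x $ u) powr p + cmod (y $ u) powr p"] psubset.hyps False
        by auto
      define L where "L = {u \<in> A. u < a}"
      define R where "R = {u \<in> A. a < u}"
      have LR: "L \<subset> A" "R \<subset> A" using a(1) by (auto simp: L_def R_def)
      have half: "cmod (T D) \<le> C * K * (\<rho> / 2) * \<mu> A powr (2 / p)" if "D \<subset> A" "2 * \<mu> D \<le> \<mu> A" for D
      proof -
        have "\<mu> D powr (2 / p) \<le> (\<mu> A / 2) powr (2 / p)"
          using that p \<mu>0 by (intro powr_mono2) auto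
        also have "\<dots> = (\<rho> / 2) * \<mu> A powr (2 / p)"
          using \<mu>0[of A] by (simp add: powr_divide \<rho>_def powr_diff)
        finally have "C * K * \<mu> D powr (2 / p) \<le> C * K * ((\<rho> / 2) * \<mu> A powr (2 / p))"
          using C \<open>0 \<le> K\<close> by (intro mult_left_mono) auto
        moreover have "cmod (T D) \<le> C * K * \<mu> D powr (2 / p)"
          using psubset.IH[of D] that psubset.prems by blast
        ultimately show ?thesis by (simp add: mult.assoc)
      qed
      have rect: "cmod (\<Sum>u\<in>D. \<Sum>v\<in>E. c u v) \<le> K * \<mu> A powr (2 / p)" if "D \<subseteq> A" "E \<subseteq> A" for D E
      proof -
        have "lp_mass p x D \<le> \<mu> A" "lp_mass p y E \<le> \<mu> A"
          using lp_mass_mono[OF psubset.hyps that(1), of p x] lp_mass_mono[OF psubset.hyps that(2), of p y]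
            lp_mass_nonneg[of p x A] lp_mass_nonneg[of p y A] by (auto simp: \<mu>_def)
        then have "lp_mass p x D powr (1/p) * lp_mass p y E powr (1/p) \<le> \<mu> A powr (1/p) * \<mu> A powr (1/p)"
          using p by (intro mult_mono powr_mono2) (auto simp: lp_mass_nonneg)
        also have "\<dots> = \<mu> A powr (2 / p)" by (simp flip: powr_add)
        finally have "K * (lp_mass p x D powr (1/p) * lp_mass p y E powr (1/p)) \<le> K * \<mu> A powr (2 / p)"
          using \<open>0 \<le> K\<close> by (rule mult_left_mono)
        moreover have "cmod (\<Sum>u\<in>D. \<Sum>v\<in>E. c u v) \<le>
            K * lp_mass p x D powr (1/p) * lp_mass p y E powr (1/p)"
          unfolding c_def using p(1) bd that psubset.prems by (intro bilinear_bound_lp_mass) auto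
        ultimately show ?thesis by (simp add: mult.assoc)
      qed
      have r1: "cmod (\<Sum>u\<in>L. c u a) \<le> K * \<mu> A powr (2 / p)"
        using rect[of L "{a}"] a(1) LR by auto
      have "cmod (c a a) \<le> K * \<mu> A powr (2 / p)" using rect[of "{a}" "{a}"] a(1) by auto
      then have r2: "cmod (of_real t * c a a) \<le> K * \<mu> A powr (2 / p)"
        using t by (simp add: norm_mult) (meson mult_left_le_one_le norm_ge_zero order_trans)
      have r3: "cmod (\<Sum>u\<in>insert a L. \<Sum>v\<in>R. c u v) \<le> K * \<mu> A powr (2 / p)"
        using rect[of "insert a L" R] a(1) LR by auto
      have l: "cmod (T L) \<le> C * K * (\<rho> / 2) * \<mu> A powr (2 / p)"
        and r: "cmod (T R) \<le> C * K * (\<rho> / 2) * \<mu> A powr (2 / p)"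
        using half LR a by (auto simp: L_def R_def)
      have "T A = T L + T R + (\<Sum>u\<in>L. c u a) + of_real t * c a a + (\<Sum>u\<in>insert a L. \<Sum>v\<in>R. c u v)"
        unfolding T_def using psubset.hyps a(1) L_def R_def by (rule truncated_sum_split)
      then have "cmod (T A) \<le> cmod (T L) + cmod (T R) + cmod (\<Sum>u\<in>L. c u a) + cmod (of_real t * c a a)
          + cmod (\<Sum>u\<in>insert a L. \<Sum>v\<in>R. c u v)"
        by (auto intro!: order_trans[OF norm_triangle_ineq] add_right_mono)
      also have "\<dots> \<le> (C * \<rho> + 3) * (K * \<mu> A powr (2 / p))"
        using l r r1 r2 r3 by (simp add: algebra_simps)
      finally show ?thesis using C(2) by (simp add: mult.assoc)
    qed
  qed
  then show ?thesis by (simp add: T_def c_def \<mu>_def C_def \<rho>_def)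
qed

lemma schur_bounded_truncation_lp:
  assumes p: "0 < p" "p < 2" and t: "0 \<le> t" "t \<le> 1"
  shows "schur_bounded n {v \<in> carrier_vec n. lp_norm p v \<le> 1} (truncation t)
      (3 / (1 - 2 powr (1 - 2 / p)) * 2 powr (2 / p))"
proof (rule schur_boundedI)
  let ?U = "{v \<in> carrier_vec n. lp_norm p v \<le> 1}"
  fix b K x y
  assume *: "\<And>x y. x \<in> ?U \<Longrightarrow> y \<in> ?U \<Longrightarrow> cmod (bform n b x y) \<le> K" and xy: "x \<in> ?U" "y \<in> ?U"
  have K: "0 \<le> K" using *[OF xy] norm_ge_zero order_trans by blast
  have "2 powr (1 - 2 / p) < (1::real)" using p by (rule two_powr_less_one)
  moreover have "(lp_mass p x {..<n} + lp_mass p y {..<n}) powr (2 / p) \<le> 2 powr (2 / p)"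
    using xy p lp_norm_le_1_iff[of x n p] lp_norm_le_1_iff[of y n p]
    by (intro powr_mono2) (auto simp: lp_mass_nonneg)
  ultimately have "3 / (1 - 2 powr (1 - 2 / p)) * K * (lp_mass p x {..<n} + lp_mass p y {..<n}) powr (2 / p)
      \<le> 3 / (1 - 2 powr (1 - 2 / p)) * K * 2 powr (2 / p)"
    using K by (intro mult_left_mono) auto
  moreover have "cmod (bform n (\<lambda>u v. truncation t u v * b u v) x y) \<le>
      3 / (1 - 2 powr (1 - 2 / p)) * K * (lp_mass p x {..<n} + lp_mass p y {..<n}) powr (2 / p)"
    unfolding bform_def mult.assoc[of "truncation t _ _"]
    using truncated_sum_bound[OF p t * K, of "{..<n}" x y] by simp
  ultimately show "cmod (bform n (\<lambda>u v. truncation t u v * b u v) x y) \<le>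
      3 / (1 - 2 powr (1 - 2 / p)) * 2 powr (2 / p) * K"
    by (simp add: mult_ac)
qed

section \<open>Multilinear forms\<close>

definition mform :: "nat \<Rightarrow> nat \<Rightarrow> ((nat \<Rightarrow> nat) \<Rightarrow> complex) \<Rightarrow> (nat \<Rightarrow> complex vec) \<Rightarrow> complex" where
  "mform m n a x = (\<Sum>i\<in>{1..m} \<rightarrow>\<^sub>E {..<n}. a i * (\<Prod>s=1..m. x s $ i s))"

text \<open>With all arguments but two held fixed, a multilinear form is a bilinear form in these two.\<close>

lemma mform_multiplier:
  assumes M: "schur_bounded n U M C" and qr: "q \<in> {1..m}" "r \<in> {1..m}" "q \<noteq> r"
    and bd: "\<And>x. x \<in> {1..m} \<rightarrow>\<^sub>E U \<Longrightarrow> cmod (mform m n a x) \<le> K"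
    and x: "x \<in> {1..m} \<rightarrow>\<^sub>E U"
  shows "cmod (mform m n (\<lambda>i. M (i q) (i r) * a i) x) \<le> C * K"
proof -
  define I where "I = {1..m} \<rightarrow>\<^sub>E {..<n}"
  have finI: "finite I" by (simp add: I_def finite_PiE)
  define R where "R = {1..m} - {q, r}"
  define b where "b u v = (\<Sum>i | i \<in> I \<and> (i q, i r) = (u, v). a i * (\<Prod>s\<in>R. x s $ i s))" for u v
  have key: "mform m n (\<lambda>i. W (i q) (i r) * a i) (x(q := y, r := z)) = bform n (\<lambda>u v. W u v * b u v) y z"
    for W :: "nat \<Rightarrow> nat \<Rightarrow> complex" and y z
  proof -
    define h where "h i = W (i q) (i r) * (a i * (\<Prod>s\<in>R. x s $ i s)) * (y $ i q * z $ i r)" for i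
    have "(\<Prod>s=1..m. (x(q := y, r := z)) s $ i s) = (\<Prod>s\<in>R. x s $ i s) * (y $ i q * z $ i r)" for i
    proof -
      have "{1..m} = insert q (insert r R)" using qr by (auto simp: R_def)
      moreover have "(\<Prod>s\<in>R. (x(q := y, r := z)) s $ i s) = (\<Prod>s\<in>R. x s $ i s)"
        by (intro prod.cong) (auto simp: R_def)
      moreover have "finite R" "q \<notin> R" "r \<notin> R" by (auto simp: R_def)
      ultimately show ?thesis using qr(3) by (simp add: mult_ac)
    qed
    then have "mform m n (\<lambda>i. W (i q) (i r) * a i) (x(q := y, r := z)) = sum h I"
      by (simp add: mform_def I_def h_def mult_ac)
    also have "\<dots> = (\<Sum>w\<in>{..<n} \<times> {..<n}. sum h {i \<in> I. (i q, i r) = w})"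
      using finI qr by (intro sum.group[symmetric]) (auto simp: I_def)
    also have "\<dots> = (\<Sum>u<n. \<Sum>v<n. sum h {i \<in> I. (i q, i r) = (u, v)})"
      by (auto simp: sum.cartesian_product intro!: sum.cong)
    also have "\<dots> = bform n (\<lambda>u v. W u v * b u v) y z"
      unfolding bform_def b_def sum_distrib_left sum_distrib_right
      by (intro sum.cong refl) (auto simp: h_def)
    finally show ?thesis .
  qed
  have "cmod (bform n b y z) \<le> K" if "y \<in> U" "z \<in> U" for y z
  proof -
    have "x(q := y, r := z) \<in> {1..m} \<rightarrow>\<^sub>E U" using x qr that by (auto simp: PiE_iff extensional_def)
    from bd[OF this] show ?thesis using key[of "\<lambda>_ _. 1" y z] by simp
  qed
  moreover have "x q \<in> U" "x r \<in> U" using x qr by auto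
  ultimately have "cmod (bform n (\<lambda>u v. M u v * b u v) (x q) (x r)) \<le> C * K"
    by (intro schur_boundedD[OF M])
  then show ?thesis using key[of M "x q" "x r"] by simp
qed

lemma mform_multiplier_prod:
  assumes M: "schur_bounded n U M C" and r: "r \<in> {1..m}" and "finite Q" "Q \<subseteq> {1..m} - {r}"
    and bd: "\<And>x. x \<in> {1..m} \<rightarrow>\<^sub>E U \<Longrightarrow> cmod (mform m n a x) \<le> K"
    and x: "x \<in> {1..m} \<rightarrow>\<^sub>E U"
  shows "cmod (mform m n (\<lambda>i. (\<Prod>q\<in>Q. M (i q) (i r)) * a i) x) \<le> C ^ card Q * K"
  using assms(3,4) x
proof (induction Q arbitrary: x rule: finite_induct)
  case empty
  then show ?case using bd by simp
next
  case (insert q Q)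
  have "cmod (mform m n (\<lambda>i. M (i q) (i r) * ((\<Prod>q\<in>Q. M (i q) (i r)) * a i)) x) \<le> C * (C ^ card Q * K)"
    using insert.prems r by (intro mform_multiplier[OF M] insert.IH) auto
  then show ?case using insert.hyps by (simp add: mult.assoc)
qed

section \<open>Coefficients of partial symmetrizations\<close>

definition symm_coeff :: "nat \<Rightarrow> ((nat \<Rightarrow> nat) \<Rightarrow> complex) \<Rightarrow> (nat \<Rightarrow> nat) \<Rightarrow> complex" where
  "symm_coeff k a i = (1 / fact k) * (\<Sum>\<sigma> | \<sigma> permutes {1..k}. a (i \<circ> \<sigma>))"

lemma mform_permute:
  assumes \<sigma>: "\<sigma> permutes {1..m}"
  shows "mform m n a (\<lambda>s. x (\<sigma> s)) = mform m n (\<lambda>i. a (i \<circ> \<sigma>)) x"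
proof -
  have mem: "i \<circ> \<tau> \<in> {1..m} \<rightarrow>\<^sub>E {..<n}" if "i \<in> {1..m} \<rightarrow>\<^sub>E {..<n}" "\<tau> permutes {1..m}" for i \<tau>
    using that permutes_in_image[OF that(2)] permutes_not_in[OF that(2)]
    by (auto simp: PiE_iff extensional_def)
  have inv: "\<sigma> \<circ> inv_into UNIV \<sigma> = id" "inv_into UNIV \<sigma> \<circ> \<sigma> = id" using permutes_inv_o[OF \<sigma>] by auto
  have "bij_betw (\<lambda>i. i \<circ> \<sigma>) ({1..m} \<rightarrow>\<^sub>E {..<n}) ({1..m} \<rightarrow>\<^sub>E {..<n})"
    using mem \<sigma> permutes_inv[OF \<sigma>]
    by (intro bij_betwI[where g = "\<lambda>i. i \<circ> inv_into UNIV \<sigma>"]) (auto simp: comp_assoc inv)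
  then have "mform m n a (\<lambda>s. x (\<sigma> s)) =
      (\<Sum>i\<in>{1..m} \<rightarrow>\<^sub>E {..<n}. a (i \<circ> \<sigma>) * (\<Prod>s=1..m. x (\<sigma> s) $ (i \<circ> \<sigma>) s))"
    unfolding mform_def by (rule sum.reindex_bij_betw[symmetric])
  also have "\<dots> = mform m n (\<lambda>i. a (i \<circ> \<sigma>)) x"
    using prod.permute[OF \<sigma>, of "\<lambda>s. x s $ i s" for i] by (simp add: mform_def comp_def)
  finally show ?thesis .
qed

lemma partial_symmetrization_mform:
  assumes "k \<le> m"
  shows "partial_symmetrization k (mform m n a) = mform m n (symm_coeff k a)"
proof
  fix x
  have "\<sigma> permutes {1..m}" if "\<sigma> permutes {1..k}" for \<sigma>
    using that by (rule permutes_subset) (use assms in auto)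
  then have "partial_symmetrization k (mform m n a) x =
      (1 / fact k) * (\<Sum>\<sigma> | \<sigma> permutes {1..k}. mform m n (\<lambda>i. a (i \<circ> \<sigma>)) x)"
    by (simp add: partial_symmetrization_def mform_permute)
  also have "\<dots> = mform m n (symm_coeff k a) x"
    unfolding mform_def symm_coeff_def by (subst sum.swap) (simp add: sum_distrib_left sum_distrib_right mult_ac)
  finally show "partial_symmetrization k (mform m n a) x = mform m n (symm_coeff k a) x" .
qed

text \<open>
  A permutation of \<open>{1..k - 1}\<close> does not move the \<open>k\<close>-th entry, so the larger entry \<open>i q\<close> stays in front of
  it and the rearranged tuple is not nondecreasing.
\<close>

lemma support_max:
  fixes a :: "(nat \<Rightarrow> nat) \<Rightarrow> complex"
  assumes supp: "\<And>i. a i \<noteq> 0 \<Longrightarrow> mono_on {1..m} i" and k: "1 \<le> k" "k \<le> m"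
    and \<sigma>: "\<sigma> permutes {1..k - 1}" and q: "q \<in> {1..<k}" "i k < i q"
  shows "a (i \<circ> \<sigma>) = 0"
proof (rule ccontr)
  assume "a (i \<circ> \<sigma>) \<noteq> 0"
  then have mono: "mono_on {1..m} (i \<circ> \<sigma>)" by (rule supp)
  have "{1..<k} = {1..k - 1}" using k by auto
  then have "q \<in> \<sigma> ` {1..<k}" using permutes_image[OF \<sigma>] q(1) by simp
  then obtain p where p: "p \<in> {1..<k}" "\<sigma> p = q" by blast
  have "(i \<circ> \<sigma>) p \<le> (i \<circ> \<sigma>) k"
    using mono p(1) k by (auto simp: mono_on_def)
  moreover have "\<sigma> k = k" using k by (intro permutes_not_in[OF \<sigma>]) auto
  ultimately show False using p q by simp
qed

text \<open>
  Write a permutation of \<open>{1..k}\<close> as a transposition of \<open>k\<close> with some \<open>r\<close>, followed by a permutation of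
  \<open>{1..k - 1}\<close>. If \<open>i r < i k\<close>, the transposed index has a non-maximal entry in position \<open>k\<close> and
  contributes nothing; if \<open>i r = i k\<close>, the transposition does not change \<open>i\<close>. Hence the two
  coefficients differ only by the proportion of indices \<open>r\<close> of the second kind.
\<close>

lemma symm_coeff_step:
  assumes supp: "\<And>i. a i \<noteq> 0 \<Longrightarrow> mono_on {1..m} i" and k: "1 \<le> k" "k \<le> m"
    and max: "\<And>q. q \<in> {1..k} \<Longrightarrow> i q \<le> i k"
  shows "of_nat k * symm_coeff k a i = of_nat (card {q \<in> {1..k}. i q = i k}) * symm_coeff (k - 1) a i"
proof -
  define S where "S i = (\<Sum>\<sigma> | \<sigma> permutes {1..k - 1}. a (i \<circ> \<sigma>))" for i
  have ins: "{1..k} = insert k {1..k - 1}" using k by auto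
  have S: "S (i \<circ> Transposition.transpose k r) = (if i r = i k then S i else 0)" if r: "r \<in> {1..k}" for r
  proof (cases "i r = i k")
    case True
    then have "i \<circ> Transposition.transpose k r = i" by (auto simp: fun_eq_iff Transposition.transpose_def)
    then show ?thesis using True by simp
  next
    case False
    then have "r \<in> {1..<k}" "i r < i k" using r max[OF r] by (auto simp: order_le_less)
    then have "a ((i \<circ> Transposition.transpose k r) \<circ> \<sigma>) = 0" if "\<sigma> permutes {1..k - 1}" for \<sigma>
      using that supp k by (intro support_max[where q = r and k = k]) auto
    then show ?thesis using False by (simp add: S_def)
  qed
  have "(\<Sum>\<sigma> | \<sigma> permutes {1..k}. a (i \<circ> \<sigma>)) =
      (\<Sum>r\<in>{1..k}. \<Sum>\<sigma> | \<sigma> permutes {1..k - 1}. a (i \<circ> (Transposition.transpose k r \<circ> \<sigma>)))"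
    unfolding ins by (rule sum_over_permutations_insert) (use k in auto)
  also have "\<dots> = (\<Sum>r\<in>{1..k}. if i r = i k then S i else 0)"
    using S by (intro sum.cong) (auto simp: S_def comp_assoc)
  also have "\<dots> = of_nat (card {q \<in> {1..k}. i q = i k}) * S i"
    by (simp add: sum.If_cases Int_def)
  finally have "(\<Sum>\<sigma> | \<sigma> permutes {1..k}. a (i \<circ> \<sigma>)) = of_nat (card {q \<in> {1..k}. i q = i k}) * S i" .
  then show ?thesis using k by (simp add: symm_coeff_def S_def fact_reduce[of k] field_simps)
qed

text \<open>
  The reciprocal of the multiplicity \<open>\<mu>\<close> of the maximum is not a product of functions of two
  indices, but it is the integral of \<open>t ^ (\<mu> - 1)\<close>, and this power is: every \<open>q < k\<close> with
  \<open>i q = i k\<close> contributes one factor \<open>t\<close>. The same product vanishes when \<open>i k\<close> is not maximal.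
\<close>

lemma symm_coeff_integral:
  assumes supp: "\<And>i. a i \<noteq> 0 \<Longrightarrow> mono_on {1..m} i" and k: "1 \<le> k" "k \<le> m"
  shows "((\<lambda>t. of_nat k * ((\<Prod>q\<in>{1..<k}. truncation t (i q) (i k)) * symm_coeff k a i))
      has_integral symm_coeff (k - 1) a i) {0..1}"
proof (cases "\<exists>q\<in>{1..<k}. i k < i q")
  case True
  then obtain q where q: "q \<in> {1..<k}" "i k < i q" by blast
  have "(\<Prod>q\<in>{1..<k}. truncation t (i q) (i k)) = 0" for t
    using q by (intro prod_zero bexI[of _ q]) (auto simp: truncation_def)
  moreover have "a (i \<circ> \<sigma>) = 0" if "\<sigma> permutes {1..k - 1}" for \<sigma>
    using supp k that q by (rule support_max)
  then have "symm_coeff (k - 1) a i = 0" by (simp add: symm_coeff_def)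
  ultimately show ?thesis by (simp only: mult_zero_left mult_zero_right has_integral_0)
next
  case False
  then have le: "i q \<le> i k" if "q \<in> {1..k}" for q using that by (cases "q = k") (auto simp: not_less)
  define \<nu> where "\<nu> = card {q \<in> {1..<k}. i q = i k}"
  have "{q \<in> {1..k}. i q = i k} = insert k {q \<in> {1..<k}. i q = i k}" using k by auto
  then have \<mu>: "card {q \<in> {1..k}. i q = i k} = Suc \<nu>" by (simp add: \<nu>_def)
  have prod: "(\<Prod>q\<in>{1..<k}. truncation t (i q) (i k)) = of_real t ^ \<nu>" for t
  proof -
    have "(\<Prod>q\<in>{1..<k}. truncation t (i q) (i k)) = (\<Prod>q\<in>{1..<k}. if i q = i k then of_real t else 1)"
      using le by (intro prod.cong) (auto simp: truncation_def order_le_less)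
    also have "\<dots> = of_real t ^ \<nu>" by (simp add: prod.If_cases \<nu>_def Int_def)
    finally show ?thesis .
  qed
  have "((\<lambda>t. (of_real t :: complex) ^ \<nu>) has_integral
      (of_real 1 ^ Suc \<nu> / of_nat (Suc \<nu>) - of_real 0 ^ Suc \<nu> / of_nat (Suc \<nu>))) {0..1}"
  proof (rule fundamental_theorem_of_calculus)
    fix t :: real
    have "((\<lambda>z :: complex. z ^ Suc \<nu> / of_nat (Suc \<nu>)) has_field_derivative of_real t ^ \<nu>) (at (of_real t))"
      using DERIV_cdivide[OF DERIV_power[OF DERIV_ident[of "at (complex_of_real t)"], of "Suc \<nu>"],
          of "of_nat (Suc \<nu>)"]
      by (simp del: of_nat_Suc power_Suc)
    then show "((\<lambda>t. complex_of_real t ^ Suc \<nu> / of_nat (Suc \<nu>)) has_vector_derivative of_real t ^ \<nu>)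
        (at t within {0..1})"
      by (rule has_vector_derivative_real_field)
  qed simp
  then have "((\<lambda>t. (of_real t :: complex) ^ \<nu>) has_integral (1 / of_nat (Suc \<nu>))) {0..1}" by simp
  then have "((\<lambda>t. of_nat k * (of_real t ^ \<nu> * symm_coeff k a i)) has_integral
      of_nat k * (1 / of_nat (Suc \<nu>) * symm_coeff k a i)) {0..1}"
    by (intro has_integral_mult_right has_integral_mult_left)
  moreover have "of_nat k * (1 / of_nat (Suc \<nu>) * symm_coeff k a i) = symm_coeff (k - 1) a i"
    using symm_coeff_step[of a m k i, OF supp k le] unfolding \<mu> by (simp add: field_simps del: of_nat_Suc)
  ultimately show ?thesis by (simp only: prod)
qed

section \<open>One step of symmetrization\<close>

lemma mform_symm_step:
  assumes supp: "\<And>i. a i \<noteq> 0 \<Longrightarrow> mono_on {1..m} i" and k: "1 \<le> k" "k \<le> m"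
    and trunc: "\<And>t. 0 \<le> t \<Longrightarrow> t \<le> 1 \<Longrightarrow> schur_bounded n U (truncation t) C"
    and bd: "\<And>x. x \<in> {1..m} \<rightarrow>\<^sub>E U \<Longrightarrow> cmod (mform m n (symm_coeff k a) x) \<le> K"
    and "0 \<le> C" "0 \<le> K" and x: "x \<in> {1..m} \<rightarrow>\<^sub>E U"
  shows "cmod (mform m n (symm_coeff (k - 1) a) x) \<le> real k * C ^ (k - 1) * K"
proof -
  define F where "F t = of_nat k *
      mform m n (\<lambda>i. (\<Prod>q\<in>{1..<k}. truncation t (i q) (i k)) * symm_coeff k a i) x" for t
  have "((\<lambda>t. mform m n (\<lambda>i. of_nat k * ((\<Prod>q\<in>{1..<k}. truncation t (i q) (i k)) * symm_coeff k a i)) x)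
      has_integral mform m n (symm_coeff (k - 1) a) x) {0..1}"
    unfolding mform_def
    by (intro has_integral_sum has_integral_mult_left symm_coeff_integral[of a m k, OF supp k])
      (simp_all add: finite_PiE)
  then have int: "(F has_integral mform m n (symm_coeff (k - 1) a) x) {0..1}"
    by (simp add: F_def[abs_def] mform_def sum_distrib_left mult.assoc)
  have "cmod (F t) \<le> real k * C ^ (k - 1) * K" if "t \<in> {0..1}" for t
  proof -
    have "cmod (mform m n (\<lambda>i. (\<Prod>q\<in>{1..<k}. truncation t (i q) (i k)) * symm_coeff k a i) x)
        \<le> C ^ card {1..<k} * K"
      using that k x by (intro mform_multiplier_prod[OF trunc] bd) auto
    then show ?thesis by (simp add: F_def norm_mult mult_left_mono mult.assoc)
  qed
  then show ?thesis
    using has_integral_bound_real[of "real k * C ^ (k - 1) * K" "{}" F _ 0 1] int \<open>0 \<le> C\<close> \<open>0 \<le> K\<close> by simp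
qed

lemma mform_bounded:
  assumes "\<And>x u. x \<in> U \<Longrightarrow> u < n \<Longrightarrow> cmod (x $ u) \<le> B" "x \<in> {1..m} \<rightarrow>\<^sub>E U"
  shows "cmod (mform m n a x) \<le> (\<Sum>i\<in>{1..m} \<rightarrow>\<^sub>E {..<n}. cmod (a i) * B ^ m)"
  unfolding mform_def
proof (rule order_trans[OF norm_sum] sum_mono)+
  fix i assume i: "i \<in> {1..m} \<rightarrow>\<^sub>E {..<n}"
  have "cmod (\<Prod>s=1..m. x s $ i s) \<le> (\<Prod>s=1..m. B)"
    unfolding prod_norm[symmetric] using assms i by (intro prod_mono) (fastforce simp: PiE_iff)
  then show "cmod (a i * (\<Prod>s=1..m. x s $ i s)) \<le> cmod (a i) * B ^ m"
    by (simp add: norm_mult mult_left_mono)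
qed

text \<open>
  Passing to suprema needs the coordinates of the unit ball to be bounded, so that the right-hand
  supremum is an upper bound. The factor \<open>k\<close> in front of the integral is absorbed by \<open>2 ^ k\<close>.
\<close>

lemma sup_on_balls_symm_step:
  assumes k: "1 \<le> k" "k \<le> m"
    and nonempty: "{v \<in> carrier_vec n. N v \<le> 1} \<noteq> {}"
    and coords: "\<And>x u. x \<in> carrier_vec n \<Longrightarrow> N x \<le> 1 \<Longrightarrow> u < n \<Longrightarrow> cmod (x $ u) \<le> B"
    and trunc: "\<And>t. 0 \<le> t \<Longrightarrow> t \<le> 1 \<Longrightarrow>
      schur_bounded n {v \<in> carrier_vec n. N v \<le> 1} (truncation t) C"
    and "1 \<le> C"
  shows "sup_on_balls m n N (partial_symmetrization (k - 1) (assoc_form m n P))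
    \<le> (2 * C) ^ k * sup_on_balls m n N (partial_symmetrization k (assoc_form m n P))"
proof -
  define U where "U = {v \<in> carrier_vec n. N v \<le> 1}"
  define a where "a i = (if i \<in> mono_indices m n then coefficients m n P i else 0)" for i
  have supp: "mono_on {1..m} i" if "a i \<noteq> 0" for i
    using that by (auto simp: a_def mono_indices_def split: if_splits)
  have form: "assoc_form m n P = mform m n a"
  proof
    fix x
    have "mono_indices m n \<subseteq> {1..m} \<rightarrow>\<^sub>E {..<n}" by (auto simp: mono_indices_def)
    then have "assoc_form m n P x = (\<Sum>i\<in>{1..m} \<rightarrow>\<^sub>E {..<n}. a i * (\<Prod>s=1..m. x s $ i s))"
      unfolding assoc_form_def
      by (intro sum.mono_neutral_cong_left) (auto simp: a_def finite_PiE)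
    then show "assoc_form m n P x = mform m n a x" by (simp add: mform_def)
  qed
  define K where "K = sup_on_balls m n N (mform m n (symm_coeff k a))"
  have bdd: "bdd_above ((\<lambda>x. cmod (mform m n (symm_coeff k a) x)) ` ({1..m} \<rightarrow>\<^sub>E U))"
    by (rule bdd_aboveI2, rule mform_bounded[of U n B]) (use coords in \<open>auto simp: U_def\<close>)
  have K: "cmod (mform m n (symm_coeff k a) x) \<le> K" if "x \<in> {1..m} \<rightarrow>\<^sub>E U" for x
    unfolding K_def sup_on_balls_def U_def[symmetric] using bdd that by (rule cSUP_upper2) simp
  have ne: "({1..m} \<rightarrow>\<^sub>E U) \<noteq> {}" using nonempty by (simp add: PiE_eq_empty_iff U_def)
  then have "0 \<le> K" using K norm_ge_zero order_trans by blast
  have "real k * C ^ (k - 1) \<le> 2 ^ k * C ^ k"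
  proof (rule mult_mono)
    show "real k \<le> 2 ^ k" using of_nat_less_two_power[of k] by (simp add: less_imp_le)
    show "C ^ (k - 1) \<le> C ^ k" using \<open>1 \<le> C\<close> by (intro power_increasing) auto
  qed (use \<open>1 \<le> C\<close> in auto)
  then have "real k * C ^ (k - 1) * K \<le> (2 * C) ^ k * K"
    using \<open>0 \<le> K\<close> by (simp add: power_mult_distrib mult_right_mono)
  moreover have "cmod (mform m n (symm_coeff (k - 1) a) x) \<le> real k * C ^ (k - 1) * K"
    if "x \<in> {1..m} \<rightarrow>\<^sub>E U" for x
    using supp k trunc[folded U_def] K _ \<open>0 \<le> K\<close> that by (rule mform_symm_step) (use \<open>1 \<le> C\<close> in auto)
  ultimately have "sup_on_balls m n N (mform m n (symm_coeff (k - 1) a)) \<le> (2 * C) ^ k * K"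
    unfolding sup_on_balls_def U_def[symmetric] using ne by (intro cSUP_least) (auto intro: order_trans)
  then show ?thesis using k by (simp add: form partial_symmetrization_mform K_def)
qed

section \<open>The unit balls of unconditional norms and of \<open>\<ell>\<^sub>p\<close>\<close>

lemma solid_unit_ball:
  assumes "one_unconditional n N"
  shows "solid n {v \<in> carrier_vec n. N v \<le> 1}"
  using assms unfolding solid_def one_unconditional_def by (auto intro: order_trans)

text \<open>By unconditionality, \<open>x $ u\<close> times the \<open>u\<close>-th unit vector has norm at most \<open>N x\<close>.\<close>

lemma unit_ball_coords_bounded:
  assumes N: "norm_on_Cn n N" "one_unconditional n N"
    and x: "x \<in> carrier_vec n" "N x \<le> 1" and u: "u < n"
  shows "cmod (x $ u) \<le> (\<Sum>u<n. 1 / N (unit_vec n u))"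
proof -
  have pos: "N (unit_vec n v) > 0" if "v < n" for v
  proof -
    have "unit_vec n v \<noteq> (0\<^sub>v n :: complex vec)"
      using that by (metis index_unit_vec(2) index_zero_vec(1) zero_neq_one)
    then show ?thesis using N(1) unfolding norm_on_Cn_def by (metis order_le_less unit_vec_carrier)
  qed
  have "cmod (x $ u) * N (unit_vec n u) = N (x $ u \<cdot>\<^sub>v unit_vec n u)"
    using N(1) by (simp add: norm_on_Cn_def)
  also have "\<dots> \<le> N x"
    using N(2) x(1) u unfolding one_unconditional_def by (auto simp: unit_vec_def)
  finally have "cmod (x $ u) \<le> 1 / N (unit_vec n u)"
    using x(2) pos[OF u] by (simp add: field_simps)
  also have "\<dots> \<le> (\<Sum>u<n. 1 / N (unit_vec n u))"
    using u by (intro member_le_sum) (auto intro: less_imp_le pos)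
  finally show ?thesis .
qed

lemma lp_unit_ball_coords_bounded:
  assumes "0 < p" "x \<in> carrier_vec n" "lp_norm p x \<le> 1" "u < n"
  shows "cmod (x $ u) \<le> 1"
proof (rule ccontr)
  assume "\<not> cmod (x $ u) \<le> 1"
  then have "1 < lp_mass p x {u}" using assms(1) by (simp add: lp_mass_def gr_one_powr)
  also have "\<dots> \<le> lp_mass p x {..<n}" using assms(4) by (intro lp_mass_mono) auto
  finally show False using lp_norm_le_1_iff[of x n p] assms by simp
qed

text \<open>
  For \<open>n \<ge> 2\<close> both rounding the binary logarithm up and adding one for the diagonal cost at most one
  further \<open>log 2 n \<ge> 1\<close>.
\<close>

lemma binary_digits_le_log:
  fixes n :: nat
  assumes "n \<ge> 2"
  obtains d where "n \<le> 2 ^ d" "real d + 1 \<le> 3 / ln 2 * ln (real n)"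
proof -
  define d where "d = nat \<lceil>log 2 (real n)\<rceil>"
  have log: "log 2 (real n) \<ge> 1" using assms by simp
  have "log 2 (real n) \<le> real d" unfolding d_def by linarith
  then have "real n \<le> 2 powr real d" using assms by (subst (asm) log_le_iff) auto
  then have "real n \<le> real (2 ^ d)" by (simp add: powr_realpow)
  then have "n \<le> 2 ^ d" by (simp only: of_nat_le_iff)
  moreover have "real d \<le> log 2 (real n) + 1" unfolding d_def using log by linarith
  then have "real d + 1 \<le> 3 * log 2 (real n)" using log by linarith
  ultimately show ?thesis using that by (simp add: log_def)
qed

lemma unconditional_symm_step:
  assumes n: "n \<ge> 2" and N: "norm_on_Cn n N" "one_unconditional n N" and k: "1 \<le> k" "k \<le> m"
  shows "sup_on_balls m n N (partial_symmetrization (k - 1) (assoc_form m n P))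
      \<le> (6 / ln 2 * ln (real n)) ^ k *
        sup_on_balls m n N (partial_symmetrization k (assoc_form m n P))"
proof -
  obtain d where d: "n \<le> 2 ^ d" "real d + 1 \<le> 3 / ln 2 * ln (real n)"
    using n by (rule binary_digits_le_log)
  have "sup_on_balls m n N (partial_symmetrization (k - 1) (assoc_form m n P))
      \<le> (2 * (3 / ln 2 * ln (real n))) ^ k *
        sup_on_balls m n N (partial_symmetrization k (assoc_form m n P))"
    using k
  proof (rule sup_on_balls_symm_step)
    have "N (0\<^sub>v n) = 0" using N(1) unfolding norm_on_Cn_def by (metis zero_carrier_vec)
    then show "{v \<in> carrier_vec n. N v \<le> 1} \<noteq> {}" by (auto intro!: exI[of _ "0\<^sub>v n"])
    show "cmod (x $ u) \<le> (\<Sum>u<n. 1 / N (unit_vec n u))"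
      if "x \<in> carrier_vec n" "N x \<le> 1" "u < n" for x u
      using N that by (rule unit_ball_coords_bounded)
    show "schur_bounded n {v \<in> carrier_vec n. N v \<le> 1} (truncation t) (3 / ln 2 * ln (real n))"
      if "0 \<le> t" "t \<le> 1" for t
      using schur_bounded_truncation_solid[OF solid_unit_ball[OF N(2)] d(1) that] d(2)
      by (rule schur_bounded_mono)
    show "1 \<le> 3 / ln 2 * ln (real n)" using d(2) by linarith
  qed
  then show ?thesis by simp
qed

lemma lp_symm_step:
  fixes p :: real
  assumes p: "0 < p" "p < 2" and k: "1 \<le> k" "k \<le> m"
  defines "C \<equiv> 3 / (1 - 2 powr (1 - 2 / p)) * 2 powr (2 / p)"
  shows "1 \<le> C"
    and "sup_on_balls m n (lp_norm p) (partial_symmetrization (k - 1) (assoc_form m n P))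
      \<le> (2 * C) ^ k * sup_on_balls m n (lp_norm p) (partial_symmetrization k (assoc_form m n P))"
proof -
  have "1 * 1 \<le> C" unfolding C_def
  proof (rule mult_mono)
    show "1 \<le> 3 / (1 - 2 powr (1 - 2 / p))"
      using two_powr_less_one[OF p] powr_ge_zero[of 2 "1 - 2 / p"] by (simp add: field_simps)
  qed (use p two_powr_less_one[OF p] in \<open>auto simp: ge_one_powr_ge_zero\<close>)
  then show C: "1 \<le> C" by simp
  show "sup_on_balls m n (lp_norm p) (partial_symmetrization (k - 1) (assoc_form m n P))
      \<le> (2 * C) ^ k * sup_on_balls m n (lp_norm p) (partial_symmetrization k (assoc_form m n P))"
    using k
  proof (rule sup_on_balls_symm_step)
    have "lp_norm p (0\<^sub>v n) \<le> 1" using p by (simp add: lp_norm_def)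
    then show "{v \<in> carrier_vec n. lp_norm p v \<le> 1} \<noteq> {}" by (auto intro!: exI[of _ "0\<^sub>v n"])
    show "cmod (x $ u) \<le> 1" if "x \<in> carrier_vec n" "lp_norm p x \<le> 1" "u < n" for x u
      using p(1) that by (rule lp_unit_ball_coords_bounded)
    show "schur_bounded n {v \<in> carrier_vec n. lp_norm p v \<le> 1} (truncation t) C"
      if "0 \<le> t" "t \<le> 1" for t
      unfolding C_def using p that by (rule schur_bounded_truncation_lp)
  qed (rule C)
qed

theorem theorem1p2:
  "(\<exists>c1::real. c1 \<ge> 1 \<and>
      (\<forall>(m::nat) (n::nat) P N k.
         m \<ge> 1 \<and> n \<ge> 2 \<and> homogeneous_polynomial m n P \<and>
         norm_on_Cn n N \<and> one_unconditional n N \<and> 1 \<le> k \<and> k \<le> m \<longrightarrow>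
         sup_on_balls m n N (partial_symmetrization (k - 1) (assoc_form m n P))
           \<le> (c1 * ln (real n)) ^ k *
             sup_on_balls m n N (partial_symmetrization k (assoc_form m n P)))) \<and>
   (\<forall>p::real. 1 \<le> p \<and> p < 2 \<longrightarrow>
      (\<exists>c2::real. c2 \<ge> 1 \<and>
         (\<forall>(m::nat) (n::nat) P k.
            m \<ge> 1 \<and> n \<ge> 1 \<and> homogeneous_polynomial m n P \<and> 1 \<le> k \<and> k \<le> m \<longrightarrow>
            sup_on_balls m n (lp_norm p) (partial_symmetrization (k - 1) (assoc_form m n P))
              \<le> c2 ^ k *
                sup_on_balls m n (lp_norm p) (partial_symmetrization k (assoc_form m n P)))))"
proof (intro conjI allI impI)
  show "\<exists>c1::real. c1 \<ge> 1 \<and>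
      (\<forall>(m::nat) (n::nat) P N k.
         m \<ge> 1 \<and> n \<ge> 2 \<and> homogeneous_polynomial m n P \<and>
         norm_on_Cn n N \<and> one_unconditional n N \<and> 1 \<le> k \<and> k \<le> m \<longrightarrow>
         sup_on_balls m n N (partial_symmetrization (k - 1) (assoc_form m n P))
           \<le> (c1 * ln (real n)) ^ k *
             sup_on_balls m n N (partial_symmetrization k (assoc_form m n P)))"
  proof (intro exI[of _ "6 / ln 2"] conjI allI impI)
    show "(6 / ln 2 :: real) \<ge> 1" using ln_2_less_1 by (simp add: field_simps)
  qed (use unconditional_symm_step in blast)
next
  fix p :: real
  assume "1 \<le> p \<and> p < 2"
  then have p: "0 < p" "p < 2" by auto
  define C where "C = 3 / (1 - 2 powr (1 - 2 / p)) * 2 powr (2 / p)"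
  have "1 \<le> 2 * C" using lp_symm_step(1)[OF p order_refl order_refl] by (simp add: C_def)
  then show "\<exists>c2::real. c2 \<ge> 1 \<and>
      (\<forall>(m::nat) (n::nat) P k.
         m \<ge> 1 \<and> n \<ge> 1 \<and> homogeneous_polynomial m n P \<and> 1 \<le> k \<and> k \<le> m \<longrightarrow>
         sup_on_balls m n (lp_norm p) (partial_symmetrization (k - 1) (assoc_form m n P))
           \<le> c2 ^ k * sup_on_balls m n (lp_norm p) (partial_symmetrization k (assoc_form m n P)))"
    using lp_symm_step(2)[OF p, folded C_def] by blast
qed

end
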